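(* Let $\mathcal C$ be an essentially small category and $\mathcal J$ a stable notion of covering presieve of $\mathcal C$. Let $J$ be the associated notion of covering sieve: a sieve $C\hookrightarrow y(X)$ is $J$-covering if it is the maximal sieve on $X$ or contains at least one presieve $(X_i\xrightarrow{x_i}X)_{i\in I}$ which is an element of $\mathcal J$. Let $\overline J$ be the topology of $\mathcal C$ generated by $J$. Then, for every sub-presheaf $Q\hookrightarrow P$ of a presheaf $P$ on $\mathcal C$, with $J$-closure (equivalently $\overline J$-closure) $\overline Q\hookrightarrow P$, a section $p\in P(X)$ over an object $X$ of $\mathcal C$ is an element of the subset $\overline Q(X)\subseteq P(X)$ if and only if there exists a multi-covering of type $\mathcal J$ of $X$, consisting of a tree with finite branches $A_\bullet=(A_0\xleftarrow{f_1}A_1\leftarrow\cdots\leftarrow A_{n-1}\xleftarrow{f_n}A_n\leftarrow\cdots)$, objects $X_{n,a}$ ($n\in\mathbb N$, $a\in A_n$) and morphisms $x_{n,a}:X_{n,a}\to X_{n-1,f_n(a)}$ ($n\ge1$, $a\in A_n$), such that for all $n\in\mathbb N$ and $a\in A_n$ at least one of the following holds: - $a$ is in the image of $f_{n+1}:A_{n+1}\to A_n$, i.e. the node $(n,a)$ of $A_\bullet$ is not maximal; - the empty family of morphisms with target $X_{n,a}$ is an element of $\mathcal J$; - writing $a=a_n$, $f_n(a_n)=a_{n-1},\dots,f_1(a_1)=a_0$, the composite $$X_{n,a_n}\xrightarrow{x_{n,a_n}}X_{n-1,a_{n-1}}\to\cdots\to X_{1,a_1}\xrightarrow{x_{1,a_1}}X_{0,a_0}=X$$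 sends $p\in P(X)$ into the subset $Q(X_{n,a_n})\subseteq P(X_{n,a_n})$.
   Context: A presieve on $X$ is a family of morphisms with target $X$. A notion of covering presieve $\mathcal J$ is a collection of presieves (called $\mathcal J$-covering); it is stable if for every morphism $x:X'\to X$ and every $\mathcal J$-covering presieve $(X_i\xrightarrow{x_i}X)_{i\in I}$ there is a $\mathcal J$-covering presieve $(X'_j\xrightarrow{x'_j}X')_{j\in I'}$ such that for every $j\in I'$ there are $i\in I$ and a morphism $X'_j\to X_i$ making the square with $x'_j$, $x_i$ and $x$ commute. A sub-presheaf $Q\hookrightarrow P$ is $J$-closed if, for every $J$-covering sieve $C$ on an object $X$, any $p\in P(X)$ which is sent into $Q(X')$ by every $(X'\to X)\in C$ belongs to $Q(X)$. The $J$-closure $\overline Q\hookrightarrow P$ is the smallest $J$-closed sub-presheaf of $P$ containing $Q$. The topology generated by $J$ is the smallest Grothendieck topology containing the sieves in $J$. A tree $A_\bullet$ is a sequence of sets $A_n$, $n\in\mathbb N$, with $A_0=\{a_0\}$ a singleton, and maps $f_n:A_n\to A_{n-1}$, $n\ge1$. Its nodes are the pairs $(n,a)$ with $a\in A_n$, ordered by $(n,a)\ge(m,b)$ iff $n\ge m$ and $b=(f_{m+1}\circ\cdots\circ f_n)(a)$. It has finite branches if every non-empty subset of the ordered set of nodes has at least one maximal element. A multi-covering of type $\mathcal J$ of $X$ consists of a tree with finite branches $A_\bullet$, objects $X_{n,a}$ of $\mathcal C$ indexed by the nodes, with $X_{0,a_0}=X$, and morphisms $x_{n,a}:X_{n,a}\to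 X_{n-1,f_n(a)}$ ($n\ge1$, $a\in A_n$), such that for every non-maximal node $(n,a)$ (i.e. $f_{n+1}^{-1}(a)\neq\emptyset$) the family $(x_{n+1,a'}:X_{n+1,a'}\to X_{n,a})_{a'\in f_{n+1}^{-1}(a)}$ is a $\mathcal J$-covering presieve. *)

theory Defs
  imports Main
begin

section \<open>Categories and presheaves\<close>

text \<open>
  The objects and the morphisms of a category form subsets of two types, so they are sets:
  smallness is built into the setting, and there is no separate size hypothesis.
  \<open>cmp C g f\<close> is the composite of \<open>f\<close> followed by \<open>g\<close>.
\<close>

record ('o, 'm) cat_data =
  Ob :: "'o set"
  Ar :: "'m set"
  src :: "'m \<Rightarrow> 'o"
  tgt :: "'m \<Rightarrow> 'o"
  ident :: "'o \<Rightarrow> 'm"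
  cmp :: "'m \<Rightarrow> 'm \<Rightarrow> 'm"

definition hom :: "('o, 'm) cat_data \<Rightarrow> 'o \<Rightarrow> 'o \<Rightarrow> 'm set" where
  "hom C X Y = {f \<in> Ar C. src C f = X \<and> tgt C f = Y}"

locale category =
  fixes C :: "('o, 'm) cat_data"
  assumes src_Ob: "f \<in> Ar C \<Longrightarrow> src C f \<in> Ob C"
    and tgt_Ob: "f \<in> Ar C \<Longrightarrow> tgt C f \<in> Ob C"
    and ident_hom: "X \<in> Ob C \<Longrightarrow> ident C X \<in> hom C X X"
    and cmp_hom: "f \<in> hom C X Y \<Longrightarrow> g \<in> hom C Y Z \<Longrightarrow> cmp C g f \<in> hom C X Z"
    and cmp_ident_right: "f \<in> hom C X Y \<Longrightarrow> cmp C f (ident C X) = f"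
    and cmp_ident_left: "f \<in> hom C X Y \<Longrightarrow> cmp C (ident C Y) f = f"
    and cmp_assoc: "f \<in> hom C W X \<Longrightarrow> g \<in> hom C X Y \<Longrightarrow> h \<in> hom C Y Z \<Longrightarrow>
      cmp C h (cmp C g f) = cmp C (cmp C h g) f"

record ('o, 'm, 'v) psh_data =
  sec :: "'o \<Rightarrow> 'v set"
  res :: "'m \<Rightarrow> 'v \<Rightarrow> 'v"

locale presheaf = category C for C :: "('o, 'm) cat_data" +
  fixes P :: "('o, 'm, 'v) psh_data"
  assumes res_sec: "f \<in> hom C X Y \<Longrightarrow> p \<in> sec P Y \<Longrightarrow> res P f p \<in> sec P X"
    and res_ident: "X \<in> Ob C \<Longrightarrow> p \<in> sec P X \<Longrightarrow> res P (ident C X) p = p"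
    and res_cmp: "f \<in> hom C X Y \<Longrightarrow> g \<in> hom C Y Z \<Longrightarrow> p \<in> sec P Z \<Longrightarrow>
      res P (cmp C g f) p = res P f (res P g p)"

definition subpresheaf ::
    "('o, 'm) cat_data \<Rightarrow> ('o, 'm, 'v) psh_data \<Rightarrow> ('o \<Rightarrow> 'v set) \<Rightarrow> bool" where
  "subpresheaf C P Q \<longleftrightarrow>
     (\<forall>X\<in>Ob C. Q X \<subseteq> sec P X) \<and>
     (\<forall>f\<in>Ar C. \<forall>q\<in>Q (tgt C f). res P f q \<in> Q (src C f))"


section \<open>Sieves and Grothendieck topologies\<close>

definition is_sieve :: "('o, 'm) cat_data \<Rightarrow> 'o \<Rightarrow> 'm set \<Rightarrow> bool" where
  "is_sieve C X S \<longleftrightarrow>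
     S \<subseteq> {f \<in> Ar C. tgt C f = X} \<and>
     (\<forall>f\<in>S. \<forall>g\<in>Ar C. tgt C g = src C f \<longrightarrow> cmp C f g \<in> S)"

definition max_sieve :: "('o, 'm) cat_data \<Rightarrow> 'o \<Rightarrow> 'm set" where
  "max_sieve C X = {f \<in> Ar C. tgt C f = X}"

definition pullback_sieve :: "('o, 'm) cat_data \<Rightarrow> 'm \<Rightarrow> 'm set \<Rightarrow> 'm set" where
  "pullback_sieve C f S = {g \<in> Ar C. tgt C g = src C f \<and> cmp C f g \<in> S}"

definition grothendieck_topology ::
    "('o, 'm) cat_data \<Rightarrow> ('o \<Rightarrow> 'm set set) \<Rightarrow> bool" where
  "grothendieck_topology C T \<longleftrightarrow>
     (\<forall>X\<in>Ob C. \<forall>S\<in>T X. is_sieve C X S) \<and>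
     (\<forall>X\<in>Ob C. max_sieve C X \<in> T X) \<and>
     (\<forall>f\<in>Ar C. \<forall>S\<in>T (tgt C f). pullback_sieve C f S \<in> T (src C f)) \<and>
     (\<forall>X\<in>Ob C. \<forall>S\<in>T X. \<forall>R. is_sieve C X R \<longrightarrow>
        (\<forall>f\<in>S. pullback_sieve C f R \<in> T (src C f)) \<longrightarrow> R \<in> T X)"

definition generated_topology ::
    "('o, 'm) cat_data \<Rightarrow> ('o \<Rightarrow> 'm set set) \<Rightarrow> 'o \<Rightarrow> 'm set set" where
  "generated_topology C K X =
     {S. is_sieve C X S \<and>
         (\<forall>T. grothendieck_topology C T \<longrightarrow> (\<forall>Y\<in>Ob C. K Y \<subseteq> T Y) \<longrightarrow> S \<in> T X)}"

definition closed_subpresheaf ::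
    "('o, 'm) cat_data \<Rightarrow> ('o \<Rightarrow> 'm set set) \<Rightarrow> ('o, 'm, 'v) psh_data \<Rightarrow> ('o \<Rightarrow> 'v set) \<Rightarrow> bool" where
  "closed_subpresheaf C K P Q \<longleftrightarrow>
     subpresheaf C P Q \<and>
     (\<forall>X\<in>Ob C. \<forall>S\<in>K X. \<forall>p\<in>sec P X.
        (\<forall>f\<in>S. res P f p \<in> Q (src C f)) \<longrightarrow> p \<in> Q X)"

definition psh_closure ::
    "('o, 'm) cat_data \<Rightarrow> ('o \<Rightarrow> 'm set set) \<Rightarrow> ('o, 'm, 'v) psh_data \<Rightarrow> ('o \<Rightarrow> 'v set) \<Rightarrow> 'o \<Rightarrow> 'v set"
  where
  "psh_closure C K P Q X =
     {p \<in> sec P X. \<forall>R. closed_subpresheaf C K P R \<longrightarrow> (\<forall>Y\<in>Ob C. Q Y \<subseteq> R Y) \<longrightarrow> p \<in> R X}"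


section \<open>Notions of covering presieve\<close>

text \<open>
  A family with target \<open>X\<close> is a pair \<open>(I, x)\<close> of an index set and a function; only the
  restriction of \<open>x\<close> to \<open>I\<close> matters. \<open>\<J> X\<close> collects the covering families with target \<open>X\<close>,
  so empty families with different targets are distinguished.
\<close>

type_synonym ('o, 'm, 'i) presieves = "'o \<Rightarrow> ('i set \<times> ('i \<Rightarrow> 'm)) set"

definition covering_presieve_notion ::
    "('o, 'm) cat_data \<Rightarrow> ('o, 'm, 'i) presieves \<Rightarrow> bool" where
  "covering_presieve_notion C \<J> \<longleftrightarrow>
     (\<forall>X\<in>Ob C. \<forall>(I, x)\<in>\<J> X. \<forall>i\<in>I. x i \<in> Ar C \<and> tgt C (x i) = X)"

definition stable_presieves ::
    "('o, 'm) cat_data \<Rightarrow> ('o, 'm, 'i) presieves \<Rightarrow> bool" where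
  "stable_presieves C \<J> \<longleftrightarrow>
     (\<forall>u\<in>Ar C. \<forall>(I, x)\<in>\<J> (tgt C u). \<exists>(I', x')\<in>\<J> (src C u).
        \<forall>j\<in>I'. \<exists>i\<in>I. \<exists>h\<in>hom C (src C (x' j)) (src C (x i)).
          cmp C u (x' j) = cmp C (x i) h)"

definition covering_sieves ::
    "('o, 'm) cat_data \<Rightarrow> ('o, 'm, 'i) presieves \<Rightarrow> 'o \<Rightarrow> 'm set set" where
  "covering_sieves C \<J> X =
     {S. is_sieve C X S \<and> (S = max_sieve C X \<or> (\<exists>(I, x)\<in>\<J> X. x ` I \<subseteq> S))}"

text \<open>
  A family indexed by an arbitrary set, such as a fibre in a tree, is a covering presieve if it
  is a member of \<open>\<J>\<close> up to a bijective change of index set. Equality of index sets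
  would be too strict: the disjoint fibres over two nodes may carry the same covering family.
\<close>

definition is_covering_family ::
    "('o, 'm, 'i) presieves \<Rightarrow> 'o \<Rightarrow> 't set \<Rightarrow> ('t \<Rightarrow> 'm) \<Rightarrow> bool" where
  "is_covering_family \<J> X B z \<longleftrightarrow>
     (\<exists>(I, x)\<in>\<J> X. \<exists>\<phi>. bij_betw \<phi> B I \<and> (\<forall>b\<in>B. z b = x (\<phi> b)))"


section \<open>Trees and multi-coverings\<close>

definition is_tree :: "(nat \<Rightarrow> 't set) \<Rightarrow> (nat \<Rightarrow> 't \<Rightarrow> 't) \<Rightarrow> bool" where
  "is_tree A f \<longleftrightarrow> (\<exists>a0. A 0 = {a0}) \<and> (\<forall>n. \<forall>a\<in>A (Suc n). f (Suc n) a \<in> A n)"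

definition nodes :: "(nat \<Rightarrow> 't set) \<Rightarrow> (nat \<times> 't) set" where
  "nodes A = Sigma UNIV A"

text \<open>\<open>descend f m k\<close> is \<open>f (m + 1) \<circ> \<dots> \<circ> f (m + k)\<close>.\<close>

primrec descend :: "(nat \<Rightarrow> 't \<Rightarrow> 't) \<Rightarrow> nat \<Rightarrow> nat \<Rightarrow> 't \<Rightarrow> 't" where
  "descend f m 0 a = a"
| "descend f m (Suc k) a = descend f m k (f (Suc (m + k)) a)"

definition node_le :: "(nat \<Rightarrow> 't \<Rightarrow> 't) \<Rightarrow> nat \<times> 't \<Rightarrow> nat \<times> 't \<Rightarrow> bool" where
  "node_le f v w \<longleftrightarrow> fst v \<le> fst w \<and> snd v = descend f (fst v) (fst w - fst v) (snd w)"

definition finite_branches :: "(nat \<Rightarrow> 't set) \<Rightarrow> (nat \<Rightarrow> 't \<Rightarrow> 't) \<Rightarrow> bool" where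
  "finite_branches A f \<longleftrightarrow>
     (\<forall>N\<subseteq>nodes A. N \<noteq> {} \<longrightarrow> (\<exists>v\<in>N. \<forall>w\<in>N. node_le f v w \<longrightarrow> w = v))"

definition fibre :: "(nat \<Rightarrow> 't set) \<Rightarrow> (nat \<Rightarrow> 't \<Rightarrow> 't) \<Rightarrow> nat \<Rightarrow> 't \<Rightarrow> 't set" where
  "fibre A f n a = {b \<in> A (Suc n). f (Suc n) b = a}"

text \<open>
  The values \<open>f 0\<close> and \<open>x 0\<close> below are never used. Types cannot be quantified inside a
  formula, so a statement that a multi-covering exists has to fix the type \<open>'t\<close> of tree elements.
  The type \<open>'i list\<close> suffices when \<open>\<J>\<close> has index sets in \<open>'i\<close>: label a node
  by the indices along its path from the root.
\<close>

definition multi_covering ::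
    "('o, 'm) cat_data \<Rightarrow> ('o, 'm, 'i) presieves \<Rightarrow> 'o \<Rightarrow> (nat \<Rightarrow> 't set) \<Rightarrow> (nat \<Rightarrow> 't \<Rightarrow> 't) \<Rightarrow>
     (nat \<Rightarrow> 't \<Rightarrow> 'o) \<Rightarrow> (nat \<Rightarrow> 't \<Rightarrow> 'm) \<Rightarrow> bool" where
  "multi_covering C \<J> X A f Xs x \<longleftrightarrow>
     is_tree A f \<and> finite_branches A f \<and>
     (\<forall>n. \<forall>a\<in>A n. Xs n a \<in> Ob C) \<and>
     (\<forall>a\<in>A 0. Xs 0 a = X) \<and>
     (\<forall>n. \<forall>a\<in>A (Suc n). x (Suc n) a \<in> hom C (Xs (Suc n) a) (Xs n (f (Suc n) a))) \<and>
     (\<forall>n. \<forall>a\<in>A n. fibre A f n a \<noteq> {} \<longrightarrow>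
        is_covering_family \<J> (Xs n a) (fibre A f n a) (x (Suc n)))"

primrec path_to_root ::
    "('o, 'm) cat_data \<Rightarrow> (nat \<Rightarrow> 't \<Rightarrow> 't) \<Rightarrow> (nat \<Rightarrow> 't \<Rightarrow> 'o) \<Rightarrow> (nat \<Rightarrow> 't \<Rightarrow> 'm) \<Rightarrow>
     nat \<Rightarrow> 't \<Rightarrow> 'm" where
  "path_to_root C f Xs x 0 a = ident C (Xs 0 a)"
| "path_to_root C f Xs x (Suc n) a =
     cmp C (path_to_root C f Xs x n (f (Suc n) a)) (x (Suc n) a)"

definition nodes_resolve ::
    "('o, 'm) cat_data \<Rightarrow> ('o, 'm, 'i) presieves \<Rightarrow> ('o, 'm, 'v) psh_data \<Rightarrow> ('o \<Rightarrow> 'v set) \<Rightarrow> 'v \<Rightarrow>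
     (nat \<Rightarrow> 't set) \<Rightarrow> (nat \<Rightarrow> 't \<Rightarrow> 't) \<Rightarrow> (nat \<Rightarrow> 't \<Rightarrow> 'o) \<Rightarrow> (nat \<Rightarrow> 't \<Rightarrow> 'm) \<Rightarrow> bool" where
  "nodes_resolve C \<J> P Q p A f Xs x \<longleftrightarrow>
     (\<forall>n. \<forall>a\<in>A n.
        a \<in> f (Suc n) ` A (Suc n) \<or>
        (\<exists>e. ({}, e) \<in> \<J> (Xs n a)) \<or>
        res P (path_to_root C f Xs x n a) p \<in> Q (Xs n a))"


section \<open>The intersections above are least elements\<close>

lemma psh_closure_least:
  assumes "presheaf C P" and "subpresheaf C P Q"
  shows "closed_subpresheaf C K P (psh_closure C K P Q)"
    and "X \<in> Ob C \<Longrightarrow> Q X \<subseteq> psh_closure C K P Q X"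
    and "closed_subpresheaf C K P R \<Longrightarrow> (\<And>Y. Y \<in> Ob C \<Longrightarrow> Q Y \<subseteq> R Y) \<Longrightarrow>
      psh_closure C K P Q X \<subseteq> R X"
proof -
  interpret presheaf C P by fact
  have "res P f q \<in> sec P (src C f)" if "f \<in> Ar C" "q \<in> sec P (tgt C f)" for f q
    using res_sec that by (auto simp: hom_def)
  then have sub: "subpresheaf C P (psh_closure C K P Q)"
    by (auto simp: subpresheaf_def psh_closure_def closed_subpresheaf_def)
  have "p \<in> psh_closure C K P Q X"
    if "X \<in> Ob C" "S \<in> K X" "p \<in> sec P X" "\<forall>f\<in>S. res P f p \<in> psh_closure C K P Q (src C f)"
    for X S p
    unfolding psh_closure_def
  proof (intro CollectI conjI allI impI)
    fix R assume R: "closed_subpresheaf C K P R" "\<forall>Y\<in>Ob C. Q Y \<subseteq> R Y"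
    then have "\<forall>f\<in>S. res P f p \<in> R (src C f)"
      using that(4) by (auto simp: psh_closure_def)
    then show "p \<in> R X"
      using R(1) that by (auto simp: closed_subpresheaf_def)
  qed (use that in auto)
  with sub show "closed_subpresheaf C K P (psh_closure C K P Q)"
    by (auto simp: closed_subpresheaf_def)
  show "X \<in> Ob C \<Longrightarrow> Q X \<subseteq> psh_closure C K P Q X"
    using assms(2) by (auto simp: psh_closure_def subpresheaf_def)
  show "closed_subpresheaf C K P R \<Longrightarrow> (\<And>Y. Y \<in> Ob C \<Longrightarrow> Q Y \<subseteq> R Y) \<Longrightarrow>
      psh_closure C K P Q X \<subseteq> R X"
    by (auto simp: psh_closure_def)
qed

lemma generated_topology_least:
  assumes "category C"
    and sieves: "\<And>X S. X \<in> Ob C \<Longrightarrow> S \<in> K X \<Longrightarrow> is_sieve C X S"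
  shows "grothendieck_topology C (generated_topology C K)"
    and "X \<in> Ob C \<Longrightarrow> K X \<subseteq> generated_topology C K X"
    and "grothendieck_topology C T \<Longrightarrow> (\<And>Y. Y \<in> Ob C \<Longrightarrow> K Y \<subseteq> T Y) \<Longrightarrow>
      generated_topology C K X \<subseteq> T X"
proof -
  interpret category C by fact
  have max: "is_sieve C X (max_sieve C X)" for X
    unfolding is_sieve_def
  proof (intro conjI ballI impI)
    fix f g assume "f \<in> max_sieve C X" "g \<in> Ar C" "tgt C g = src C f"
    then have "g \<in> hom C (src C g) (src C f)" "f \<in> hom C (src C f) X"
      by (auto simp: hom_def max_sieve_def)
    from cmp_hom[OF this] show "cmp C f g \<in> max_sieve C X"
      by (auto simp: hom_def max_sieve_def)
  qed (auto simp: max_sieve_def)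
  have pull: "is_sieve C (src C f) (pullback_sieve C f S)"
    if f: "f \<in> Ar C" and S: "is_sieve C (tgt C f) S" for f S
    unfolding is_sieve_def
  proof (intro conjI ballI impI)
    fix g h
    assume g: "g \<in> pullback_sieve C f S" and h: "h \<in> Ar C" "tgt C h = src C g"
    then have hh: "h \<in> hom C (src C h) (src C g)" "g \<in> hom C (src C g) (src C f)"
      "f \<in> hom C (src C f) (tgt C f)"
      using f by (auto simp: hom_def pullback_sieve_def)
    have "cmp C f g \<in> hom C (src C g) (tgt C f)"
      using hh cmp_hom by blast
    then have "cmp C (cmp C f g) h \<in> S"
      using S g h by (auto simp: is_sieve_def pullback_sieve_def hom_def)
    moreover have "cmp C g h \<in> hom C (src C h) (src C f)"
      using hh cmp_hom by blast
    ultimately show "cmp C g h \<in> pullback_sieve C f S"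
      using cmp_assoc[OF hh] by (auto simp: pullback_sieve_def hom_def)
  qed (auto simp: pullback_sieve_def)
  show "grothendieck_topology C (generated_topology C K)"
    unfolding grothendieck_topology_def
  proof (intro conjI ballI allI impI)
    fix X S assume "X \<in> Ob C" "S \<in> generated_topology C K X"
    then show "is_sieve C X S" by (simp add: generated_topology_def)
  next
    fix X assume "X \<in> Ob C"
    then show "max_sieve C X \<in> generated_topology C K X"
      using max by (auto simp: generated_topology_def grothendieck_topology_def)
  next
    fix f S assume "f \<in> Ar C" "S \<in> generated_topology C K (tgt C f)"
    then show "pullback_sieve C f S \<in> generated_topology C K (src C f)"
      using pull[of f S] unfolding generated_topology_def grothendieck_topology_def by blast
  next
    fix X S R
    assume *: "X \<in> Ob C" "S \<in> generated_topology C K X" "is_sieve C X R"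
      "\<forall>f\<in>S. pullback_sieve C f R \<in> generated_topology C K (src C f)"
    show "R \<in> generated_topology C K X"
      unfolding generated_topology_def
    proof (intro CollectI conjI allI impI)
      fix T assume T: "grothendieck_topology C T" "\<forall>Y\<in>Ob C. K Y \<subseteq> T Y"
      then have "S \<in> T X" "\<forall>f\<in>S. pullback_sieve C f R \<in> T (src C f)"
        using * by (auto simp: generated_topology_def)
      moreover have "\<forall>X\<in>Ob C. \<forall>S\<in>T X. \<forall>R. is_sieve C X R \<longrightarrow>
        (\<forall>f\<in>S. pullback_sieve C f R \<in> T (src C f)) \<longrightarrow> R \<in> T X"
        using T(1) unfolding grothendieck_topology_def by (elim conjE)
      ultimately show "R \<in> T X"
        using *(1,3) by blast
    qed fact
  qed
  show "X \<in> Ob C \<Longrightarrow> K X \<subseteq> generated_topology C K X"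
    using sieves by (auto simp: generated_topology_def)
  show "grothendieck_topology C T \<Longrightarrow> (\<And>Y. Y \<in> Ob C \<Longrightarrow> K Y \<subseteq> T Y) \<Longrightarrow>
      generated_topology C K X \<subseteq> T X"
    by (auto simp: generated_topology_def)
qed

end

theory Submission
  imports Defs
begin

text \<open>
  The conditions defining the closure are monotone, so the closure of \<open>Q\<close> can be generated from
  below: a section is in it when it is in \<open>Q\<close>, or when its restrictions along some covering
  presieve are already in it. Call such sections locally in \<open>Q\<close>. That these sections form a closed
  sub-presheaf (\<open>locally_in_closed\<close>) is where stability of \<open>\<J>\<close> enters: to restrict a
  derivation along \<open>u\<close>, one refines the pullback of each covering presieve used in it. Nesting
  derivations to any depth makes up for the missing transitivity of \<open>\<J>\<close>.

  A derivation that \<open>p\<close> is locally in \<open>Q\<close> is a well-founded tree whose inner nodes carry covering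
  presieves and whose leaves are sections of \<open>Q\<close>; this amounts to a multi-covering
  that resolves \<open>p\<close>. In one direction, a derivation is stored as an element of a datatype, whose
  nodes, addressed by the indices along the path from the root, form a tree with finite branches
  because the subtree relation of a datatype is well-founded (\<open>finite_branches_level\<close>). In the
  other direction, consider the nodes at which the restriction of \<open>p\<close> is not locally in \<open>Q\<close>.
  If there were any, there would be a maximal one, all of whose children are good; but then the
  covering family formed by the children makes it good as well (\<open>multi_covering_locally_in\<close>).

  Passing to the generated topology changes nothing: for a fixed closed \<open>R\<close>, the sieves that
  detect membership in \<open>R\<close> after every base change form a Grothendieck topology, and stability puts
  the \<open>\<J>\<close>-covering sieves into it (\<open>closed_generated_topology_iff\<close>).
\<close>

section \<open>Sections lying locally in the sub-presheaf\<close>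

inductive locally_in ::
    "('o, 'm) cat_data \<Rightarrow> ('o, 'm, 'i) presieves \<Rightarrow> ('o, 'm, 'v) psh_data \<Rightarrow> ('o \<Rightarrow> 'v set) \<Rightarrow>
     'o \<Rightarrow> 'v \<Rightarrow> bool"
  for C \<J> P Q where
  base: "p \<in> Q X \<Longrightarrow> locally_in C \<J> P Q X p"
| cover: "(I, x) \<in> \<J> X \<Longrightarrow> (\<And>i. i \<in> I \<Longrightarrow> locally_in C \<J> P Q (src C (x i)) (res P (x i) p)) \<Longrightarrow>
    locally_in C \<J> P Q X p"

locale stable_coverage = presheaf C P
  for C :: "('o, 'm) cat_data" and P :: "('o, 'm, 'v) psh_data" +
  fixes \<J> :: "('o, 'm, 'i) presieves"
    and Q :: "'o \<Rightarrow> 'v set"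
  assumes notion: "covering_presieve_notion C \<J>"
    and stable: "stable_presieves C \<J>"
    and sub: "subpresheaf C P Q"
begin

abbreviation "loc \<equiv> locally_in C \<J> P Q"
abbreviation "K \<equiv> covering_sieves C \<J>"

lemma hom_self: "f \<in> Ar C \<Longrightarrow> f \<in> hom C (src C f) (tgt C f)"
  by (simp add: hom_def)

lemma hom_Ob: "f \<in> hom C X Y \<Longrightarrow> X \<in> Ob C \<and> Y \<in> Ob C"
  using src_Ob tgt_Ob by (auto simp: hom_def)

lemma covering_hom:
  assumes "X \<in> Ob C" "(I, x) \<in> \<J> X" "i \<in> I"
  shows "x i \<in> hom C (src C (x i)) X"
proof -
  have "x i \<in> Ar C \<and> tgt C (x i) = X"
    using notion assms unfolding covering_presieve_notion_def by blast
  then show ?thesis by (simp add: hom_def)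
qed

lemma stable_covering:
  assumes "u \<in> hom C Y X" "(I, x) \<in> \<J> X"
  obtains I' x' where "(I', x') \<in> \<J> Y"
    "\<And>j. j \<in> I' \<Longrightarrow> \<exists>i\<in>I. \<exists>h\<in>hom C (src C (x' j)) (src C (x i)). cmp C u (x' j) = cmp C (x i) h"
  using stable assms unfolding stable_presieves_def hom_def by fast

text \<open>
  In the covering step, the given presieve is replaced by one on \<open>Y\<close> each of whose members,
  followed by \<open>u\<close>, factors as \<open>x i \<circ> h\<close>; restricting along \<open>h\<close> is then the induction hypothesis.
  The hypothesis must therefore be generalized over \<open>u\<close>.
\<close>

lemma locally_in_restrict:
  assumes "loc X p" "u \<in> hom C Y X" "p \<in> sec P X"
  shows "loc Y (res P u p)"
  using assms
proof (induction arbitrary: Y u rule: locally_in.induct)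
  case (base p X)
  then have "res P u p \<in> Q Y"
    using sub by (auto simp: subpresheaf_def hom_def)
  then show ?case by (rule locally_in.base)
next
  case (cover I x X p)
  obtain I' x' where J': "(I', x') \<in> \<J> Y"
    and lift: "\<And>j. j \<in> I' \<Longrightarrow>
      \<exists>i\<in>I. \<exists>h\<in>hom C (src C (x' j)) (src C (x i)). cmp C u (x' j) = cmp C (x i) h"
    using stable_covering[OF cover.prems(1) cover.hyps(1)] by blast
  have Ob: "X \<in> Ob C" "Y \<in> Ob C" using hom_Ob cover.prems(1) by auto
  show ?case
  proof (rule locally_in.cover[where \<J> = \<J> and x = x', OF J'])
    fix j assume j: "j \<in> I'"
    then obtain i h where i: "i \<in> I" and h: "h \<in> hom C (src C (x' j)) (src C (x i))"
      and eq: "cmp C u (x' j) = cmp C (x i) h"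
      using lift by blast
    have xi: "x i \<in> hom C (src C (x i)) X" using covering_hom[OF Ob(1) cover.hyps(1) i] .
    have "res P (x' j) (res P u p) = res P (cmp C u (x' j)) p"
      using res_cmp[OF covering_hom[OF Ob(2) J' j] cover.prems] by simp
    also have "\<dots> = res P h (res P (x i) p)"
      using res_cmp[OF h xi cover.prems(2)] eq by simp
    finally show "loc (src C (x' j)) (res P (x' j) (res P u p))"
      using cover.IH[OF i h res_sec[OF xi cover.prems(2)]] by simp
  qed
qed

lemma ident_max_sieve: "X \<in> Ob C \<Longrightarrow> ident C X \<in> max_sieve C X"
  using ident_hom[of X] by (simp add: max_sieve_def hom_def)

lemma locally_in_closed: "closed_subpresheaf C K P (\<lambda>X. {p \<in> sec P X. loc X p})"
  unfolding closed_subpresheaf_def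
proof (intro conjI ballI impI)
  show "subpresheaf C P (\<lambda>X. {p \<in> sec P X. loc X p})"
    using locally_in_restrict[OF _ hom_self] res_sec[OF hom_self] by (auto simp: subpresheaf_def)
next
  fix X S p
  assume X: "X \<in> Ob C" and S: "S \<in> K X" and p: "p \<in> sec P X"
    and S_loc: "\<forall>f\<in>S. res P f p \<in> {q \<in> sec P (src C f). loc (src C f) q}"
  have "loc X p"
  proof (cases "S = max_sieve C X")
    case True
    then have "loc X (res P (ident C X) p)"
      using S_loc ident_max_sieve[OF X] ident_hom[OF X] by (auto simp: hom_def)
    then show ?thesis using res_ident[OF X p] by simp
  next
    case False
    then obtain I x where J: "(I, x) \<in> \<J> X" and "x ` I \<subseteq> S"
      using S by (auto simp: covering_sieves_def)
    then show ?thesis using S_loc by (intro locally_in.cover[where \<J> = \<J>, OF J]) auto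
  qed
  with p show "p \<in> {p \<in> sec P X. loc X p}" by simp
qed

text \<open>
  Closedness is formulated with sieves, whereas local membership uses presieves; the sieve generated
  by a covering presieve translates one into the other.
\<close>

lemma generated_sieve:
  assumes "X \<in> Ob C" "(I, x) \<in> \<J> X"
  shows "{cmp C (x i) h | i h. i \<in> I \<and> h \<in> Ar C \<and> tgt C h = src C (x i)} \<in> K X" (is "?S \<in> _")
proof -
  have hom: "cmp C (x i) h \<in> hom C (src C h) X" if "i \<in> I" "h \<in> Ar C" "tgt C h = src C (x i)" for i h
    using cmp_hom[OF _ covering_hom[OF assms that(1)]] that by (simp add: hom_def)
  have "is_sieve C X ?S"
    unfolding is_sieve_def
  proof (intro conjI ballI impI)
    show "?S \<subseteq> {f \<in> Ar C. tgt C f = X}" using hom by (auto simp: hom_def)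
  next
    fix f g assume "f \<in> ?S" and g: "g \<in> Ar C" "tgt C g = src C f"
    then obtain i h where f: "f = cmp C (x i) h" and ih: "i \<in> I" "h \<in> Ar C" "tgt C h = src C (x i)"
      by blast
    have gh: "g \<in> hom C (src C g) (src C h)"
      using g hom[OF ih] by (simp add: f hom_def)
    have hh: "h \<in> hom C (src C h) (src C (x i))" using ih by (simp add: hom_def)
    have "cmp C f g = cmp C (x i) (cmp C h g)"
      using cmp_assoc[OF gh hh covering_hom[OF assms ih(1)]] by (simp add: f)
    then show "cmp C f g \<in> ?S"
      using ih cmp_hom[OF gh hh] by (auto simp: hom_def)
  qed
  moreover have "x i \<in> ?S" if "i \<in> I" for i
  proof -
    have xi: "x i \<in> hom C (src C (x i)) X" using covering_hom[OF assms that] .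
    have "ident C (src C (x i)) \<in> hom C (src C (x i)) (src C (x i))"
      using ident_hom hom_Ob[OF xi] by blast
    then show ?thesis using that cmp_ident_right[OF xi] by (force simp: hom_def)
  qed
  ultimately show ?thesis using assms(2) by (force simp: covering_sieves_def)
qed

lemma locally_in_psh_closure:
  assumes "loc X p" "X \<in> Ob C" "p \<in> sec P X"
  shows "p \<in> psh_closure C K P Q X"
  using assms
proof (induction rule: locally_in.induct)
  case (base p X)
  then show ?case
    using psh_closure_least(2)[OF presheaf_axioms sub] by blast
next
  case (cover I x X p)
  let ?R = "psh_closure C K P Q"
  have closed: "closed_subpresheaf C K P ?R"
    by (rule psh_closure_least(1)[OF presheaf_axioms sub])
  let ?S = "{cmp C (x i) h | i h. i \<in> I \<and> h \<in> Ar C \<and> tgt C h = src C (x i)}"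
  have "res P f p \<in> ?R (src C f)" if f_mem: "f \<in> ?S" for f
  proof -
    obtain i h where f: "f = cmp C (x i) h" and ih: "i \<in> I" "h \<in> Ar C" "tgt C h = src C (x i)"
      using f_mem by blast
    have xi: "x i \<in> hom C (src C (x i)) X" using covering_hom[OF cover.prems(1) cover.hyps(1) ih(1)] .
    have hh: "h \<in> hom C (src C h) (src C (x i))" using ih by (simp add: hom_def)
    have "res P (x i) p \<in> ?R (src C (x i))"
      using cover.IH[OF ih(1)] hom_Ob[OF xi] res_sec[OF xi cover.prems(2)] by blast
    then have "res P h (res P (x i) p) \<in> ?R (src C h)"
      using closed ih by (auto simp: closed_subpresheaf_def subpresheaf_def)
    then show ?thesis
      using res_cmp[OF hh xi cover.prems(2)] cmp_hom[OF hh xi] by (simp add: f hom_def)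
  qed
  then show ?case
    using closed generated_sieve[OF cover.prems(1) cover.hyps(1)] cover.prems
    unfolding closed_subpresheaf_def by blast
qed

lemma psh_closure_iff_locally_in:
  assumes "X \<in> Ob C" "p \<in> sec P X"
  shows "p \<in> psh_closure C K P Q X \<longleftrightarrow> loc X p"
proof
  have "Q Y \<subseteq> {q \<in> sec P Y. loc Y q}" if "Y \<in> Ob C" for Y
    using sub that by (auto simp: subpresheaf_def intro: locally_in.base)
  then show "loc X p" if "p \<in> psh_closure C K P Q X"
    using that psh_closure_least(3)[OF presheaf_axioms sub locally_in_closed] by blast
qed (use assms locally_in_psh_closure in blast)


section \<open>The generated topology has the same closed sub-presheaves\<close>

text \<open>
  The sieves that are covering for the finest topology in which \<open>R\<close> is closed in \<open>P\<close>. The base change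
  along every \<open>u\<close> is part of the condition because sieves that only detect membership of sections over
  \<open>X\<close> itself need not be stable under pullback.
\<close>

definition detecting_sieves :: "('o \<Rightarrow> 'v set) \<Rightarrow> 'o \<Rightarrow> 'm set set" where
  "detecting_sieves R X = {S. is_sieve C X S \<and>
     (\<forall>Y. \<forall>u\<in>hom C Y X. \<forall>p\<in>sec P Y.
        (\<forall>g\<in>pullback_sieve C u S. res P g p \<in> R (src C g)) \<longrightarrow> p \<in> R Y)}"

lemma pullback_is_sieve:
  assumes u: "u \<in> hom C Y X" and S: "is_sieve C X S"
  shows "is_sieve C Y (pullback_sieve C u S)"
  unfolding is_sieve_def
proof (intro conjI ballI impI)
  show "pullback_sieve C u S \<subseteq> {f \<in> Ar C. tgt C f = Y}"
    using u by (auto simp: pullback_sieve_def hom_def)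
next
  fix g h assume g: "g \<in> pullback_sieve C u S" and h: "h \<in> Ar C" "tgt C h = src C g"
  have gg: "g \<in> hom C (src C g) Y" and hh: "h \<in> hom C (src C h) (src C g)"
    using u g h by (auto simp: pullback_sieve_def hom_def)
  have "cmp C (cmp C u g) h \<in> S"
    using S g h cmp_hom[OF gg u] by (auto simp: is_sieve_def pullback_sieve_def hom_def)
  then show "cmp C g h \<in> pullback_sieve C u S"
    using cmp_assoc[OF hh gg u] cmp_hom[OF hh gg] u by (auto simp: pullback_sieve_def hom_def)
qed

lemma pullback_pullback:
  assumes u: "u \<in> hom C Y X" and v: "v \<in> hom C Z Y"
  shows "pullback_sieve C v (pullback_sieve C u S) = pullback_sieve C (cmp C u v) S"
proof -
  have "cmp C v g \<in> hom C (src C g) Y \<and> cmp C u (cmp C v g) = cmp C (cmp C u v) g"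
    if "g \<in> Ar C" "tgt C g = Z" for g
  proof -
    have g: "g \<in> hom C (src C g) Z" using that by (simp add: hom_def)
    show ?thesis using cmp_hom[OF g v] cmp_assoc[OF g v u] by simp
  qed
  then show ?thesis
    using u v cmp_hom[OF v u] by (auto simp: pullback_sieve_def hom_def)
qed

lemma max_sieve_is_sieve: "is_sieve C X (max_sieve C X)"
  unfolding is_sieve_def
proof (intro conjI ballI impI)
  fix f g assume "f \<in> max_sieve C X" "g \<in> Ar C" "tgt C g = src C f"
  then show "cmp C f g \<in> max_sieve C X"
    using cmp_hom[of g "src C g" "src C f" f X] by (auto simp: max_sieve_def hom_def)
qed (auto simp: max_sieve_def)

lemma pullback_max_sieve:
  assumes u: "u \<in> hom C Y X"
  shows "pullback_sieve C u (max_sieve C X) = max_sieve C Y"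
proof -
  have "cmp C u g \<in> hom C (src C g) X" if "g \<in> Ar C" "tgt C g = Y" for g
    using cmp_hom[OF _ u] that by (simp add: hom_def)
  then show ?thesis using u by (auto simp: pullback_sieve_def max_sieve_def hom_def)
qed

text \<open>
  The stability axiom on presieves, restated for sieves: the presieve on \<open>Y\<close> supplied by the axiom
  consists of members of the pullback, because \<open>S\<close> absorbs precomposition.
\<close>

lemma pullback_covering_sieve:
  assumes u: "u \<in> hom C Y X" and S: "S \<in> K X"
  shows "pullback_sieve C u S \<in> K Y"
proof -
  have sieve: "is_sieve C X S" using S by (simp add: covering_sieves_def)
  have "pullback_sieve C u S = max_sieve C Y \<or> (\<exists>(I', x')\<in>\<J> Y. x' ` I' \<subseteq> pullback_sieve C u S)"
  proof (cases "S = max_sieve C X")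
    case True
    then show ?thesis using pullback_max_sieve[OF u] by simp
  next
    case False
    then obtain I x where J: "(I, x) \<in> \<J> X" and xS: "x ` I \<subseteq> S"
      using S by (auto simp: covering_sieves_def)
    obtain I' x' where J': "(I', x') \<in> \<J> Y"
      and lift: "\<And>j. j \<in> I' \<Longrightarrow>
        \<exists>i\<in>I. \<exists>h\<in>hom C (src C (x' j)) (src C (x i)). cmp C u (x' j) = cmp C (x i) h"
      using stable_covering[OF u J] by blast
    have "x' j \<in> pullback_sieve C u S" if j: "j \<in> I'" for j
    proof -
      obtain i h where "i \<in> I" "h \<in> hom C (src C (x' j)) (src C (x i))"
        "cmp C u (x' j) = cmp C (x i) h" using lift[OF j] by blast
      then have "cmp C u (x' j) \<in> S"
        using xS sieve by (auto simp: is_sieve_def hom_def)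
      then show ?thesis
        using covering_hom[OF _ J' j] hom_Ob[OF u] u by (auto simp: pullback_sieve_def hom_def)
    qed
    then show ?thesis using J' by blast
  qed
  then show ?thesis
    using pullback_is_sieve[OF u sieve] by (simp add: covering_sieves_def)
qed

lemma pullback_ident:
  assumes "X \<in> Ob C" "is_sieve C X S"
  shows "pullback_sieve C (ident C X) S = S"
proof -
  have "cmp C (ident C X) g = g" if "g \<in> Ar C" "tgt C g = X" for g
    using cmp_ident_left[of g "src C g" X] that by (simp add: hom_def)
  then show ?thesis
    using assms ident_hom[OF assms(1)] by (auto simp: pullback_sieve_def hom_def is_sieve_def)
qed

text \<open>
  Only transitivity needs an argument. Detection by \<open>S\<close> reduces \<open>p\<close> to its restrictions \<open>g\<^sup>*p\<close> with
  \<open>u \<circ> g \<in> S\<close>, and each of these is detected by the pullback of \<open>S'\<close> along \<open>u \<circ> g\<close>.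
\<close>

lemma detecting_topology:
  assumes R: "subpresheaf C P R"
  shows "grothendieck_topology C (detecting_sieves R)"
  unfolding grothendieck_topology_def
proof (intro conjI ballI allI impI)
  fix X S assume "S \<in> detecting_sieves R X"
  then show "is_sieve C X S" by (simp add: detecting_sieves_def)
next
  fix X
  have "p \<in> R Y" if "u \<in> hom C Y X" "p \<in> sec P Y"
    "\<forall>g\<in>pullback_sieve C u (max_sieve C X). res P g p \<in> R (src C g)" for Y u p
  proof -
    have Y: "Y \<in> Ob C" using hom_Ob that(1) by blast
    then have "res P (ident C Y) p \<in> R Y"
      using that(3) ident_max_sieve[OF Y] ident_hom[OF Y] unfolding pullback_max_sieve[OF that(1)]
      by (auto simp: hom_def)
    then show ?thesis using res_ident[OF Y that(2)] by simp
  qed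
  then show "max_sieve C X \<in> detecting_sieves R X"
    using max_sieve_is_sieve by (auto simp: detecting_sieves_def)
next
  fix f S assume f: "f \<in> Ar C" and S: "S \<in> detecting_sieves R (tgt C f)"
  have "p \<in> R Y" if "u \<in> hom C Y (src C f)" "p \<in> sec P Y"
    "\<forall>g\<in>pullback_sieve C u (pullback_sieve C f S). res P g p \<in> R (src C g)" for Y u p
    using S that cmp_hom[OF that(1) hom_self[OF f]]
    unfolding pullback_pullback[OF hom_self[OF f] that(1)] detecting_sieves_def by blast
  then show "pullback_sieve C f S \<in> detecting_sieves R (src C f)"
    using S pullback_is_sieve[OF hom_self[OF f]] by (auto simp: detecting_sieves_def)
next
  fix X S S'
  assume S: "S \<in> detecting_sieves R X" and S': "is_sieve C X S'"
    and local: "\<forall>f\<in>S. pullback_sieve C f S' \<in> detecting_sieves R (src C f)"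
  have "p \<in> R Y" if u: "u \<in> hom C Y X" and p: "p \<in> sec P Y"
    and det: "\<forall>g\<in>pullback_sieve C u S'. res P g p \<in> R (src C g)" for Y u p
  proof -
    have "res P g p \<in> R (src C g)" if g: "g \<in> pullback_sieve C u S" for g
    proof -
      let ?f = "cmp C u g"
      have gY: "g \<in> hom C (src C g) Y" using g u by (auto simp: pullback_sieve_def hom_def)
      have Z: "src C g \<in> Ob C" using hom_Ob[OF gY] by blast
      have f: "?f \<in> S" "src C ?f = src C g"
        using g cmp_hom[OF gY u] by (auto simp: pullback_sieve_def hom_def)
      then have D: "pullback_sieve C ?f S' \<in> detecting_sieves R (src C g)"
        using local by metis
      have "res P h (res P g p) \<in> R (src C h)" if h: "h \<in> pullback_sieve C ?f S'" for h
      proof -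
        have hg: "h \<in> hom C (src C h) (src C g)"
          using h f by (auto simp: pullback_sieve_def hom_def)
        have "cmp C g h \<in> pullback_sieve C u S'"
          using h cmp_assoc[OF hg gY u] cmp_hom[OF hg gY] u
          by (auto simp: pullback_sieve_def hom_def)
        then show ?thesis
          using det res_cmp[OF hg gY p] cmp_hom[OF hg gY] by (auto simp: hom_def)
      qed
      moreover have "pullback_sieve C (ident C (src C g)) (pullback_sieve C ?f S')
          = pullback_sieve C ?f S'"
        using pullback_ident[OF Z] D by (simp add: detecting_sieves_def)
      ultimately show ?thesis
        using D ident_hom[OF Z] res_sec[OF gY p] unfolding detecting_sieves_def by auto
    qed
    then show ?thesis using S u p unfolding detecting_sieves_def by blast
  qed
  then show "S' \<in> detecting_sieves R X"
    using S' by (auto simp: detecting_sieves_def)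
qed

lemma closed_generated_topology_iff:
  "closed_subpresheaf C (generated_topology C K) P R \<longleftrightarrow> closed_subpresheaf C K P R"
proof
  assume "closed_subpresheaf C (generated_topology C K) P R"
  moreover have "K X \<subseteq> generated_topology C K X" if "X \<in> Ob C" for X
    using generated_topology_least(2)[OF category_axioms _ that, of K]
    by (auto simp: covering_sieves_def)
  ultimately show "closed_subpresheaf C K P R"
    unfolding closed_subpresheaf_def by blast
next
  assume R: "closed_subpresheaf C K P R"
  then have subR: "subpresheaf C P R" by (simp add: closed_subpresheaf_def)
  have "K Y \<subseteq> detecting_sieves R Y" for Y
  proof
    fix S assume S: "S \<in> K Y"
    have "p \<in> R Z" if u: "u \<in> hom C Z Y" and "p \<in> sec P Z"
      "\<forall>g\<in>pullback_sieve C u S. res P g p \<in> R (src C g)" for Z u p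
      using R pullback_covering_sieve[OF u S] hom_Ob[OF u] that
      unfolding closed_subpresheaf_def by blast
    then show "S \<in> detecting_sieves R Y"
      using S by (auto simp: detecting_sieves_def covering_sieves_def)
  qed
  then have gen: "generated_topology C K X \<subseteq> detecting_sieves R X" for X
    using generated_topology_least(3)[OF category_axioms _ detecting_topology[OF subR], of K]
    by (auto simp: covering_sieves_def)
  show "closed_subpresheaf C (generated_topology C K) P R"
    unfolding closed_subpresheaf_def
  proof (intro conjI subR ballI impI)
    fix X S p assume X: "X \<in> Ob C" and S: "S \<in> generated_topology C K X" and p: "p \<in> sec P X"
      and det: "\<forall>f\<in>S. res P f p \<in> R (src C f)"
    have D: "S \<in> detecting_sieves R X" using S gen by blast
    then have "pullback_sieve C (ident C X) S = S"
      using pullback_ident[OF X] by (simp add: detecting_sieves_def)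
    then show "p \<in> R X"
      using D ident_hom[OF X] p det unfolding detecting_sieves_def by auto
  qed
qed

lemma psh_closure_generated_topology:
  "psh_closure C (generated_topology C K) P Q X = psh_closure C K P Q X"
  by (simp add: psh_closure_def closed_generated_topology_iff)


section \<open>From a multi-covering to local membership\<close>

lemma locally_in_covering_family:
  assumes "is_covering_family \<J> X B z"
    and "\<And>b. b \<in> B \<Longrightarrow> loc (src C (z b)) (res P (z b) p)"
  shows "loc X p"
proof -
  obtain I x \<phi> where J: "(I, x) \<in> \<J> X" and \<phi>: "bij_betw \<phi> B I" "\<And>b. b \<in> B \<Longrightarrow> z b = x (\<phi> b)"
    using assms(1) unfolding is_covering_family_def by blast
  show ?thesis
  proof (rule locally_in.cover[where \<J> = \<J>, OF J])
    fix i assume "i \<in> I"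
    then obtain b where "b \<in> B" "i = \<phi> b" using \<phi>(1) by (auto simp: bij_betw_def)
    then show "loc (src C (x i)) (res P (x i) p)" using assms(2)[of b] \<phi>(2)[of b] by simp
  qed
qed

lemma path_to_root_hom:
  assumes "multi_covering C \<J> X A f Xs x" "a \<in> A n"
  shows "path_to_root C f Xs x n a \<in> hom C (Xs n a) X"
  using assms(2)
proof (induction n arbitrary: a)
  case 0
  then show ?case
    using assms(1) ident_hom[of "Xs 0 a"] by (auto simp: multi_covering_def)
next
  case (Suc n)
  then have "f (Suc n) a \<in> A n" "x (Suc n) a \<in> hom C (Xs (Suc n) a) (Xs n (f (Suc n) a))"
    using assms(1) by (auto simp: multi_covering_def is_tree_def)
  then show ?case using Suc.IH cmp_hom by simp
qed

text \<open>
  Finite branches say that every non-empty set of nodes has a maximal element, which is an induction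
  principle from the tips of the tree towards the root; the proof applies it to the set of
  counterexamples. A childless node is resolved either by \<open>Q\<close> or by the empty covering family, and the
  latter is an instance of the covering step with nothing to check.
\<close>

lemma multi_covering_locally_in:
  assumes X: "X \<in> Ob C" and p: "p \<in> sec P X"
    and mc: "multi_covering C \<J> X A f Xs x" and nr: "nodes_resolve C \<J> P Q p A f Xs x"
  shows "loc X p"
proof -
  let ?p = "\<lambda>n a. res P (path_to_root C f Xs x n a) p"
  define N where "N = {(n, a). a \<in> A n \<and> \<not> loc (Xs n a) (?p n a)}"
  have "N = {}"
  proof (rule ccontr)
    assume "N \<noteq> {}"
    moreover have "N \<subseteq> nodes A" by (auto simp: N_def nodes_def)
    ultimately obtain v where v: "v \<in> N" and vmax: "\<And>w. w \<in> N \<Longrightarrow> node_le f v w \<Longrightarrow> w = v"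
      using mc unfolding multi_covering_def finite_branches_def by meson
    obtain n a where na: "v = (n, a)" by fastforce
    have a: "a \<in> A n" and bad: "\<not> loc (Xs n a) (?p n a)"
      using v na by (auto simp: N_def)
    show False
    proof (cases "fibre A f n a = {}")
      case True
      then have "a \<notin> f (Suc n) ` A (Suc n)" by (auto simp: fibre_def)
      then consider e where "({}, e) \<in> \<J> (Xs n a)" | "?p n a \<in> Q (Xs n a)"
        using nr a unfolding nodes_resolve_def by blast
      then show False
      proof cases
        case 1
        have "loc (Xs n a) (?p n a)"
          by (rule locally_in.cover[where \<J> = \<J>, OF 1]) simp
        with bad show False by (rule notE)
      next
        case 2
        with bad show False by (auto intro: locally_in.base)
      qed
    next
      case False
      have children: "loc (src C (x (Suc n) b)) (res P (x (Suc n) b) (?p n a))" if b: "b \<in> fibre A f n a" for b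
      proof -
        have bA: "b \<in> A (Suc n)" and fb: "f (Suc n) b = a" using b by (auto simp: fibre_def)
        have xb: "x (Suc n) b \<in> hom C (Xs (Suc n) b) (Xs n a)"
          using mc bA fb by (auto simp: multi_covering_def)
        have "node_le f v (Suc n, b)" using na fb by (simp add: node_le_def)
        then have "(Suc n, b) \<notin> N" using vmax[of "(Suc n, b)"] na by auto
        then have "loc (Xs (Suc n) b) (?p (Suc n) b)" using bA by (simp add: N_def)
        then show ?thesis
          using res_cmp[OF xb path_to_root_hom[OF mc a] p] fb xb by (simp add: hom_def)
      qed
      have "is_covering_family \<J> (Xs n a) (fibre A f n a) (x (Suc n))"
        using mc a False by (simp add: multi_covering_def)
      then have "loc (Xs n a) (?p n a)" using children by (rule locally_in_covering_family)
      with bad show False by (rule notE)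
    qed
  qed
  obtain a0 where root: "a0 \<in> A 0" "Xs 0 a0 = X"
    using mc by (auto simp: multi_covering_def is_tree_def)
  then have "loc (Xs 0 a0) (?p 0 a0)" using \<open>N = {}\<close> unfolding N_def by blast
  then show ?thesis using res_ident[OF X p] root by simp
qed

end


section \<open>From local membership to a multi-covering\<close>

text \<open>
  Derivations of local membership as data. Index sets may be infinite, so the branches of
  one tree, although all finite, need not be bounded in length. \<open>Branch {} x s\<close> is a tip closed by an empty covering
  family, as opposed to \<open>Leaf\<close>, a tip closed by \<open>Q\<close>.
\<close>

datatype ('i, 'm) cov_tree =
  Leaf
| Branch (idx: "'i set") (arr: "'i \<Rightarrow> 'm") (child: "'i \<Rightarrow> ('i, 'm) cov_tree")
where "idx Leaf = {}"

abbreviation subtree :: "('i, 'm) cov_tree \<Rightarrow> 'i list \<Rightarrow> ('i, 'm) cov_tree" where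
  "subtree \<equiv> foldl child"

text \<open>
  Addresses grow at their end, so that dropping the last letter is the parent map and the arrow
  from a node to its parent can be read off at the parent.
\<close>

primrec level :: "('i, 'm) cov_tree \<Rightarrow> nat \<Rightarrow> 'i list set" where
  "level t 0 = {[]}"
| "level t (Suc n) = {w @ [i] | w i. w \<in> level t n \<and> i \<in> idx (subtree t w)}"

lemma length_level: "w \<in> level t n \<Longrightarrow> length w = n"
  by (induction n arbitrary: w) auto

lemma fibre_level:
  assumes "w \<in> level t n"
  shows "fibre (level t) (\<lambda>_. butlast) n w = (\<lambda>i. w @ [i]) ` idx (subtree t w)"
  using assms by (auto simp: fibre_def)

lemma descend_butlast: "descend (\<lambda>_. butlast) m k w = take (length w - k) w"
  by (induction k arbitrary: w) (auto simp: butlast_conv_take min_def)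

definition child_rel :: "('i, 'm) cov_tree rel" where
  "child_rel = {(child t i, t) | t i. i \<in> idx t}"

lemma wf_child_rel: "wf child_rel"
proof (rule wfUNIVI)
  fix Pr :: "('i, 'm) cov_tree \<Rightarrow> bool" and t
  assume step: "\<forall>t. (\<forall>s. (s, t) \<in> child_rel \<longrightarrow> Pr s) \<longrightarrow> Pr t"
  show "Pr t"
    by (induction t) (rule step[rule_format], auto simp: child_rel_def)+
qed

lemma subtree_below:
  "w @ u \<in> level t (length w + length u) \<Longrightarrow> u \<noteq> [] \<Longrightarrow> (subtree t (w @ u), subtree t w) \<in> child_rel\<^sup>+"
proof (induction u rule: rev_induct)
  case (snoc i u)
  have mem: "w @ u \<in> level t (length w + length u)" and "i \<in> idx (subtree t (w @ u))"
    using snoc.prems(1) by auto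
  then have step: "(subtree t (w @ u @ [i]), subtree t (w @ u)) \<in> child_rel"
    by (auto simp: child_rel_def)
  show ?case
  proof (cases "u = []")
    case True
    with step show ?thesis by auto
  next
    case False
    with step snoc.IH[OF mem] show ?thesis by (meson trancl_into_trancl2)
  qed
qed simp

text \<open>
  Moving away from the root passes to proper subtrees, so a node of \<open>N\<close> whose subtree is minimal for the
  proper subtree relation is maximal in the order of nodes.
\<close>

lemma finite_branches_level: "finite_branches (level t) (\<lambda>_. butlast)"
  unfolding finite_branches_def
proof (intro allI impI)
  fix N assume N: "N \<subseteq> nodes (level t)" and "N \<noteq> {}"
  then obtain s where "s \<in> (\<lambda>v. subtree t (snd v)) ` N"
    and smin: "\<And>s'. (s', s) \<in> child_rel\<^sup>+ \<Longrightarrow> s' \<notin> (\<lambda>v. subtree t (snd v)) ` N"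
    using wfE_min[OF wf_trancl[OF wf_child_rel]] by (metis (no_types, lifting) equals0I image_is_empty)
  then obtain v where v: "v \<in> N" "s = subtree t (snd v)" by blast
  have "w = v" if w: "w \<in> N" and le: "node_le (\<lambda>_. butlast) v w" for w
  proof (rule ccontr)
    assume "w \<noteq> v"
    obtain n a m b where nm: "v = (n, a)" "w = (m, b)" by fastforce
    have lev: "b \<in> level t m" "length a = n" "length b = m"
      using N v w nm length_level by (auto simp: nodes_def)
    have le': "n \<le> m" "a = take n b"
      using le nm lev by (auto simp: node_le_def descend_butlast)
    define u where "u = drop n b"
    have b: "b = a @ u" using le' by (simp add: u_def)
    then have "u \<noteq> []" using \<open>w \<noteq> v\<close> nm lev by auto
    then have "(subtree t b, s) \<in> child_rel\<^sup>+"
      using subtree_below[of a u t] lev b v(2) nm by simp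
    then show False using smin w nm by force
  qed
  then show "\<exists>v\<in>N. \<forall>w\<in>N. node_le (\<lambda>_. butlast) v w \<longrightarrow> w = v" using v(1) by blast
qed

text \<open>
  The root has no arrow: there \<open>last w\<close> is unspecified, so \<open>node_ob\<close> has to treat it separately.
  The level \<open>n\<close> always equals the length of the address \<open>w\<close>.
\<close>

definition node_arr :: "('i, 'm) cov_tree \<Rightarrow> nat \<Rightarrow> 'i list \<Rightarrow> 'm" where
  "node_arr t n w = arr (subtree t (butlast w)) (last w)"

definition node_ob :: "('o, 'm) cat_data \<Rightarrow> 'o \<Rightarrow> ('i, 'm) cov_tree \<Rightarrow> nat \<Rightarrow> 'i list \<Rightarrow> 'o" where
  "node_ob C X t n w = (if w = [] then X else src C (node_arr t n w))"

context stable_coverage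
begin

primrec certifies :: "('i, 'm) cov_tree \<Rightarrow> 'o \<Rightarrow> 'v \<Rightarrow> bool" where
  "certifies Leaf X p \<longleftrightarrow> p \<in> Q X"
| "certifies (Branch I x s) X p \<longleftrightarrow>
     (I, x) \<in> \<J> X \<and> (\<forall>i\<in>I. certifies (s i) (src C (x i)) (res P (x i) p))"

text \<open>
  Choice is needed to assemble derivations for possibly infinitely many children into one tree.
\<close>

lemma locally_in_certified: "loc X p \<Longrightarrow> \<exists>t. certifies t X p"
proof (induction rule: locally_in.induct)
  case (base p X)
  then have "certifies Leaf X p" by simp
  then show ?case ..
next
  case (cover I x X p)
  then obtain s where "\<forall>i\<in>I. certifies (s i) (src C (x i)) (res P (x i) p)" by metis
  with cover.hyps(1) have "certifies (Branch I x s) X p" by simp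
  then show ?case ..
qed

context
  fixes X p t
  assumes X: "X \<in> Ob C" and p: "p \<in> sec P X" and cert: "certifies t X p"
begin

abbreviation "path \<equiv> path_to_root C (\<lambda>_. butlast) (node_ob C X t) (node_arr t)"

lemma certifies_child:
  assumes "certifies s Y q" "i \<in> idx s" "Y \<in> Ob C"
  shows "certifies (child s i) (src C (arr s i)) (res P (arr s i) q)"
    and "arr s i \<in> hom C (src C (arr s i)) Y"
  using assms covering_hom by (cases s; auto)+

text \<open>
  Everything about the multi-covering attached to a certificate follows from this: at each address, the
  remaining subtree certifies the restriction of \<open>p\<close> along the path to the root.
\<close>

lemma node_invariant:
  assumes "w \<in> level t n"
  shows "path n w \<in> hom C (node_ob C X t n w) X
    \<and> certifies (subtree t w) (node_ob C X t n w) (res P (path n w) p)"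
  using assms
proof (induction n arbitrary: w)
  case 0
  then show ?case using ident_hom[OF X] res_ident[OF X p] cert by (simp add: node_ob_def)
next
  case (Suc n)
  then obtain v i where w: "w = v @ [i]" and v: "v \<in> level t n" and i: "i \<in> idx (subtree t v)" by auto
  let ?x = "arr (subtree t v) i" and ?Y = "node_ob C X t n v"
  have path: "path n v \<in> hom C ?Y X" and c: "certifies (subtree t v) ?Y (res P (path n v) p)"
    using Suc.IH[OF v] by auto
  have Y: "?Y \<in> Ob C" using hom_Ob[OF path] by blast
  have x: "?x \<in> hom C (src C ?x) ?Y" using certifies_child(2)[OF c i Y] .
  have arrow: "node_arr t (Suc n) (v @ [i]) = ?x"
    by (simp add: node_arr_def)
  then have ob: "node_ob C X t (Suc n) (v @ [i]) = src C ?x"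
    by (simp add: node_ob_def)
  show ?case
    using certifies_child(1)[OF c i Y] cmp_hom[OF x path] res_cmp[OF x path p]
    by (simp add: w ob arrow)
qed

lemma node_ob_Ob: "w \<in> level t n \<Longrightarrow> node_ob C X t n w \<in> Ob C"
  using node_invariant hom_Ob by blast

lemma level_multi_covering:
  "multi_covering C \<J> X (level t) (\<lambda>_. butlast) (node_ob C X t) (node_arr t)"
  unfolding multi_covering_def
proof (intro conjI allI ballI impI)
  show "is_tree (level t) (\<lambda>_. butlast)" by (auto simp: is_tree_def)
  show "finite_branches (level t) (\<lambda>_. butlast)" by (rule finite_branches_level)
  show "node_ob C X t n a \<in> Ob C" if "a \<in> level t n" for n a
    using node_ob_Ob that .
  show "node_ob C X t 0 a = X" if "a \<in> level t 0" for a
    using that by (simp add: node_ob_def)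
  show "node_arr t (Suc n) a \<in> hom C (node_ob C X t (Suc n) a) (node_ob C X t n (butlast a))"
    if a: "a \<in> level t (Suc n)" for n a
  proof -
    obtain v i where w: "a = v @ [i]" and v: "v \<in> level t n" and i: "i \<in> idx (subtree t v)"
      using a by auto
    show ?thesis
      using certifies_child(2)[OF conjunct2[OF node_invariant[OF v]] i node_ob_Ob[OF v]]
      by (simp add: w node_ob_def[of _ _ _ "Suc n"] node_arr_def)
  qed
  show "is_covering_family \<J> (node_ob C X t n w) (fibre (level t) (\<lambda>_. butlast) n w) (node_arr t (Suc n))"
    if w: "w \<in> level t n" and ne: "fibre (level t) (\<lambda>_. butlast) n w \<noteq> {}" for n w
  proof -
    have "idx (subtree t w) \<noteq> {}" using ne by (simp add: fibre_level[OF w])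
    then obtain I x s where s: "subtree t w = Branch I x s" by (cases "subtree t w") auto
    then have J: "(I, x) \<in> \<J> (node_ob C X t n w)" using node_invariant[OF w] by simp
    have "bij_betw last ((\<lambda>i. w @ [i]) ` I) I"
      by (auto simp: bij_betw_def inj_on_def image_image)
    moreover have "\<forall>b\<in>(\<lambda>i. w @ [i]) ` I. node_arr t (Suc n) b = x (last b)"
      by (auto simp: node_arr_def s)
    ultimately have "\<exists>\<phi>. bij_betw \<phi> ((\<lambda>i. w @ [i]) ` I) I
        \<and> (\<forall>b\<in>(\<lambda>i. w @ [i]) ` I. node_arr t (Suc n) b = x (\<phi> b))"
      by (intro exI[of _ last] conjI)
    then show ?thesis
      unfolding is_covering_family_def fibre_level[OF w] s cov_tree.sel
      by (intro bexI[where x = "(I, x)"]) (simp_all only: prod.case J)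
  qed
qed

lemma level_nodes_resolve:
  "nodes_resolve C \<J> P Q p (level t) (\<lambda>_. butlast) (node_ob C X t) (node_arr t)"
  unfolding nodes_resolve_def
proof (intro allI ballI)
  fix n w assume w: "w \<in> level t n"
  note inv = conjunct2[OF node_invariant[OF w]]
  show "w \<in> butlast ` level t (Suc n) \<or> (\<exists>e. ({}, e) \<in> \<J> (node_ob C X t n w)) \<or>
      res P (path n w) p \<in> Q (node_ob C X t n w)"
  proof (cases "subtree t w")
    case Leaf
    then show ?thesis using inv by simp
  next
    case (Branch I x s)
    show ?thesis
    proof (cases "I = {}")
      case True
      then show ?thesis using inv Branch by auto
    next
      case False
      then obtain i where "i \<in> I" by blast
      then have "w @ [i] \<in> level t (Suc n)" using w Branch by simp
      then have "w \<in> butlast ` level t (Suc n)" by (metis butlast_snoc imageI)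
      then show ?thesis ..
    qed
  qed
qed

end

end

theorem mainTheorem13:
  fixes C :: "('o, 'm) cat_data"
    and \<J> :: "('o, 'm, 'i) presieves"
    and P :: "('o, 'm, 'v) psh_data"
    and Q :: "'o \<Rightarrow> 'v set"
    and X :: 'o
    and p :: 'v
  assumes "category C"
    and "covering_presieve_notion C \<J>"
    and "stable_presieves C \<J>"
    and "presheaf C P"
    and "subpresheaf C P Q"
    and "X \<in> Ob C"
    and "p \<in> sec P X"
  shows "(\<forall>Y\<in>Ob C. psh_closure C (covering_sieves C \<J>) P Q Y =
            psh_closure C (generated_topology C (covering_sieves C \<J>)) P Q Y) \<and>
         (p \<in> psh_closure C (covering_sieves C \<J>) P Q X \<longleftrightarrow>
            (\<exists>(A :: nat \<Rightarrow> 'i list set) f Xs x.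
               multi_covering C \<J> X A f Xs x \<and> nodes_resolve C \<J> P Q p A f Xs x)) \<and>
         (\<forall>(A :: nat \<Rightarrow> 't set) f Xs x.
            multi_covering C \<J> X A f Xs x \<and> nodes_resolve C \<J> P Q p A f Xs x \<longrightarrow>
              p \<in> psh_closure C (covering_sieves C \<J>) P Q X)"
proof -
  interpret stable_coverage C P \<J> Q
    using assms by (simp add: stable_coverage_def stable_coverage_axioms_def)
  note iff = psh_closure_iff_locally_in[OF assms(6,7)]
  note sound = multi_covering_locally_in[OF assms(6,7)]
  have "\<exists>(A :: nat \<Rightarrow> 'i list set) f Xs x.
      multi_covering C \<J> X A f Xs x \<and> nodes_resolve C \<J> P Q p A f Xs x"
    if "locally_in C \<J> P Q X p"
    using locally_in_certified[OF that] level_multi_covering[OF assms(6,7)]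
      level_nodes_resolve[OF assms(6,7)] by blast
  then have "locally_in C \<J> P Q X p \<longleftrightarrow>
      (\<exists>(A :: nat \<Rightarrow> 'i list set) f Xs x.
         multi_covering C \<J> X A f Xs x \<and> nodes_resolve C \<J> P Q p A f Xs x)"
    using sound by (intro iffI) (assumption | elim exE conjE)+
  then show ?thesis
    unfolding iff psh_closure_generated_topology
    by (intro conjI ballI refl allI impI) (assumption | (elim conjE, rule sound))+
qed

end
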